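(* For every integer $n \geq 3$, the diameter of the Full-Flag Johnson graph $FJ(n,n-1)$ is $2$.
   Context: For a permutation $u=(u_1,\ldots,u_n)$ of $(1,2,\ldots,n)$ and $i \in [n]=\{1,\ldots,n\}$ write $u(i) = \{u_1, u_2, \ldots, u_i\}$. For integers $0 \leq k < n$, the Full-Flag Johnson graph $FJ(n,k)$ has as vertex set all permutations of $(1,\ldots,n)$; two vertices $u,v$ are adjacent if and only if $u(i) \neq v(i)$ for exactly $k$ integers $i \in [n]$. *)

theory Defs
  imports
    "Graph_Theory.Shortest_Path"
    "HOL-Combinatorics.Multiset_Permutations"
begin

text \<open>A permutation \<open>(u\<^sub>1, \<dots>, u\<^sub>n)\<close> of \<open>(1, \<dots>, n)\<close> is represented in one-line notation, as a
  list; \<open>flag_set u i\<close> is the set \<open>u(i) = {u\<^sub>1, \<dots>, u\<^sub>i}\<close>.\<close>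

definition flag_set :: "nat list \<Rightarrow> nat \<Rightarrow> nat set" where
  "flag_set u i = set (take i u)"

text \<open>An undirected graph is represented by the digraph having both orientations of each edge.
  For \<open>k = 0\<close> the literal adjacency condition gives a loop at every vertex and no other edge.\<close>

definition FJ :: "nat \<Rightarrow> nat \<Rightarrow> (nat list, nat list \<times> nat list) pre_digraph" where
  "FJ n k = \<lparr>
     verts = permutations_of_set {1..n},
     arcs = {(u, v). u \<in> permutations_of_set {1..n} \<and> v \<in> permutations_of_set {1..n} \<and>
                     card {i \<in> {1..n}. flag_set u i \<noteq> flag_set v i} = k},
     tail = fst,
     head = snd \<rparr>"

text \<open>With unit arc weights, \<open>\<mu>\<close> is the usual graph distance: the least number of arcs
  in a walk from \<open>u\<close> to \<open>v\<close>, and \<open>\<infinity>\<close> if there is none.\<close>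

definition graph_dist :: "('a, 'b) pre_digraph \<Rightarrow> 'a \<Rightarrow> 'a \<Rightarrow> ereal" where
  "graph_dist G u v = wf_digraph.\<mu> G (\<lambda>_. 1) u v"

definition graph_diameter :: "('a, 'b) pre_digraph \<Rightarrow> ereal" where
  "graph_diameter G = (SUP (u, v) \<in> verts G \<times> verts G. graph_dist G u v)"

text \<open>The characteristic equations of \<open>\<mu>\<close> are only available for well-formed digraphs.\<close>

lemma wf_digraph_FJ: "wf_digraph (FJ n k)"
  by unfold_locales (auto simp: FJ_def)

lemma symmetric_FJ: "symmetric (FJ n k)"
proof -
  have "card {i \<in> {1..n}. flag_set v i \<noteq> flag_set u i} =
        card {i \<in> {1..n}. flag_set u i \<noteq> flag_set v i}" for u v
    by (rule arg_cong[where f = card]) auto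
  then show ?thesis
    by (auto simp: symmetric_def sym_def arcs_ends_def arc_to_ends_def FJ_def image_iff)
qed

end

theory Submission
  imports Defs
begin

text \<open>Every proper prefix set of a permutation contains its first entry and omits its last one.
  Hence permutations \<open>u\<close> and \<open>v\<close> with \<open>u\<^sub>n = v\<^sub>1\<close> are adjacent, and if \<open>u\<^sub>n \<noteq> v\<^sub>1\<close> then any
  permutation that starts with \<open>u\<^sub>n\<close> and ends with \<open>v\<^sub>1\<close> is a common neighbour of both.
  Two permutations that differ by swapping the first two entries are distinct and have the same
  prefix set of size \<open>2 \<le> n - 1\<close>, so they are at distance at least \<open>2\<close>.\<close>

lemma hd_in_flag_set: "u \<noteq> [] \<Longrightarrow> 1 \<le> i \<Longrightarrow> hd u \<in> flag_set u i"
  by (cases u; cases i) (auto simp: flag_set_def)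

text \<open>A proper prefix leaves a nonempty suffix containing the last entry, and distinctness
  makes the two disjoint.\<close>

lemma last_notin_flag_set:
  assumes "distinct u" "i < length u"
  shows "last u \<notin> flag_set u i"
proof -
  have "last u \<in> set (drop i u)"
    using assms(2) by (metis drop_eq_Nil last_drop last_in_set leD)
  moreover have "set (take i u) \<inter> set (drop i u) = {}"
    using assms(1) set_take_disj_set_drop_if_distinct by blast
  ultimately show ?thesis
    by (auto simp: flag_set_def)
qed

text \<open>The prefix sets of size \<open>n\<close> always agree, so \<open>n - 1\<close>
  differences is the maximum and is reached only by differing at every proper prefix.\<close>

lemma arc_FJ_iff:
  assumes "u \<in> permutations_of_set {1..n}" "v \<in> permutations_of_set {1..n}" "n \<ge> 1"
  shows "(u, v) \<in> arcs (FJ n (n - 1)) \<longleftrightarrow> (\<forall>i \<in> {1..<n}. flag_set u i \<noteq> flag_set v i)"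
proof -
  let ?D = "{i \<in> {1..n}. flag_set u i \<noteq> flag_set v i}"
  have "length u = n" "length v = n" "set u = set v"
    using assms(1,2) length_finite_permutations_of_set[of _ "{1..n}"]
    by (auto dest: permutations_of_setD)
  then have "flag_set u n = flag_set v n"
    by (simp add: flag_set_def)
  have sub: "?D \<subseteq> {1..<n}"
  proof
    fix i assume i: "i \<in> ?D"
    with \<open>flag_set u n = flag_set v n\<close> have "i \<noteq> n"
      by blast
    with i show "i \<in> {1..<n}"
      by simp
  qed
  have "card ?D = n - 1 \<longleftrightarrow> ?D = {1..<n}"
  proof
    assume "card ?D = n - 1"
    then show "?D = {1..<n}"
      by (intro card_subset_eq sub) simp_all
  qed (simp only: card_atLeastLessThan)
  also have "\<dots> \<longleftrightarrow> (\<forall>i \<in> {1..<n}. flag_set u i \<noteq> flag_set v i)"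
    using sub by auto
  finally show ?thesis
    using assms(1,2) by (simp add: FJ_def)
qed

lemma arc_FJ_if_last_eq_hd:
  assumes "u \<in> permutations_of_set {1..n}" "v \<in> permutations_of_set {1..n}"
    and n: "n \<ge> 1"
    and eq: "last u = hd v"
  shows "(u, v) \<in> arcs (FJ n (n - 1))"
proof -
  have "length u = n" "length v = n" "distinct u" "v \<noteq> []"
    using n assms(1,2) length_finite_permutations_of_set[of _ "{1..n}"]
    by (auto dest: permutations_of_setD)
  then have "last u \<notin> flag_set u i" "last u \<in> flag_set v i" if "i \<in> {1..<n}" for i
    using that eq last_notin_flag_set[of u i] hd_in_flag_set[of v i] by auto
  then show ?thesis
    using arc_FJ_iff[OF assms(1,2) n] by blast
qed

lemma permutation_with_given_ends:
  assumes "finite A" "a \<in> A" "b \<in> A" "a \<noteq> b"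
  obtains w where "w \<in> permutations_of_set A" "hd w = a" "last w = b"
proof -
  obtain xs where xs: "set xs = A - {a, b}" "distinct xs"
    using finite_distinct_list[OF finite_Diff[OF assms(1)]] by blast
  show ?thesis
  proof
    show "a # xs @ [b] \<in> permutations_of_set A"
      using xs assms by (intro permutations_of_setI) auto
  qed simp_all
qed

lemma FJ_common_neighbour:
  assumes u: "u \<in> permutations_of_set {1..n}" and v: "v \<in> permutations_of_set {1..n}"
    and n: "n \<ge> 1" and ne: "last u \<noteq> hd v"
  obtains w where "(u, w) \<in> arcs (FJ n (n - 1))" "(w, v) \<in> arcs (FJ n (n - 1))"
proof -
  have set: "set u = {1..n}" "set v = {1..n}"
    using permutations_of_setD(1)[OF u] permutations_of_setD(1)[OF v] .
  \<comment> \<open>\<open>last\<close> and \<open>hd\<close> are genuine entries only for nonempty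
    lists.\<close>
  have "set u \<noteq> {}" "set v \<noteq> {}"
    unfolding set using n by simp_all
  then have "last u \<in> set u" "hd v \<in> set v"
    by simp_all
  then obtain w where w: "w \<in> permutations_of_set {1..n}" "hd w = last u" "last w = hd v"
    unfolding set by (rule permutation_with_given_ends[OF finite_atLeastAtMost _ _ ne])
  show ?thesis
  proof
    show "(u, w) \<in> arcs (FJ n (n - 1))"
      using arc_FJ_if_last_eq_hd[OF u w(1) n] w(2) by simp
    show "(w, v) \<in> arcs (FJ n (n - 1))"
      using arc_FJ_if_last_eq_hd[OF w(1) v n] w(3) by simp
  qed
qed

lemma (in wf_digraph) graph_dist_le_length:
  assumes "awalk u p v"
  shows "graph_dist G u v \<le> length p"
  using min_cost_le_walk_cost[OF assms, of "\<lambda>_. 1"]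
  by (simp add: graph_dist_def awalk_cost_def sum_list_triv)

text \<open>A walk without arcs stays at \<open>u\<close>, and a walk with one arc would make
  \<open>u\<close> and \<open>v\<close> adjacent. If no walk exists, the infimum is \<infinity> and
  the bound still holds.\<close>

lemma (in wf_digraph) graph_dist_ge_2:
  assumes "u \<noteq> v" "(u, v) \<notin> arcs_ends G"
  shows "2 \<le> graph_dist G u v"
proof -
  have "2 \<le> length p" if p: "awalk u p v" for p
  proof (rule ccontr)
    assume "\<not> 2 \<le> length p"
    then consider "p = []" | e where "p = [e]"
      by (cases p; cases "tl p") auto
    then show False
    proof cases
      case 1
      with p assms(1) show False by (simp add: awalk_Nil_iff)
    next
      case 2
      with p assms(2) show False
        by (auto simp: awalk_simps arcs_ends_def arc_to_ends_def)
    qed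
  qed
  then show ?thesis
    unfolding graph_dist_def \<mu>_def
    by (intro INF_greatest) (simp add: awalk_cost_def sum_list_triv)
qed

text \<open>Arcs are their own endpoint pairs here; this links the adjacency in
  \<open>graph_dist_ge_2\<close> to \<open>arc_FJ_iff\<close>.\<close>

lemma arcs_ends_FJ: "arcs_ends (FJ n k) = arcs (FJ n k)"
  by (simp add: arcs_ends_def arc_to_ends_def FJ_def)

lemma graph_dist_FJ_le_2:
  assumes u: "u \<in> permutations_of_set {1..n}" and v: "v \<in> permutations_of_set {1..n}"
    and n: "n \<ge> 1"
  shows "graph_dist (FJ n (n - 1)) u v \<le> 2"
proof -
  define G where "G = FJ n (n - 1)"
  interpret wf_digraph G unfolding G_def by (rule wf_digraph_FJ)
  have verts: "u \<in> verts G" "v \<in> verts G"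
    and ends: "tail G = fst" "head G = snd"
    using u v by (simp_all add: FJ_def G_def)
  have "graph_dist G u v \<le> 2"
  proof (cases "last u = hd v")
    case True
    \<comment> \<open>For \<open>n = 1\<close> this walk is the loop at the only vertex.\<close>
    then have "awalk u [(u, v)] v"
      using arc_FJ_if_last_eq_hd[OF u v n, folded G_def] verts ends by (simp add: awalk_simps)
    from graph_dist_le_length[OF this] show ?thesis
      by (rule order_trans) simp
  next
    case False
    \<comment> \<open>For \<open>n \<ge> 2\<close> the case \<open>u = v\<close> also falls here:
      the walk goes to a neighbour and back.\<close>
    then obtain w where "(u, w) \<in> arcs G" "(w, v) \<in> arcs G"
      using FJ_common_neighbour[OF u v n, folded G_def] by blast
    then have "awalk u [(u, w), (w, v)] v"
      using verts ends by (simp add: awalk_simps)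
    from graph_dist_le_length[OF this] show ?thesis
      by simp
  qed
  then show ?thesis
    unfolding G_def .
qed

theorem theorem4p2:
  fixes n :: nat
  assumes "n \<ge> 3"
  shows "graph_diameter (FJ n (n - 1)) = 2"
proof -
  let ?V = "permutations_of_set {1..n}"
  let ?u = "1 # 2 # [3..<Suc n]" and ?v = "2 # 1 # [3..<Suc n]"
  have uv: "?u \<in> ?V" "?v \<in> ?V"
    using assms by (auto simp: permutations_of_set_def simp del: upt_Suc)
  \<comment> \<open>Here \<open>n \<ge> 3\<close> makes 2 a proper prefix length; for
    \<open>n = 2\<close> the two permutations would be adjacent.\<close>
  have "flag_set ?u 2 = flag_set ?v 2" "2 \<in> {1..<n}"
    using assms by (simp_all add: flag_set_def insert_commute del: upt_Suc)
  then have "(?u, ?v) \<notin> arcs (FJ n (n - 1))"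
    using arc_FJ_iff[OF uv] assms by auto
  then have ge: "2 \<le> graph_dist (FJ n (n - 1)) ?u ?v"
    by (intro wf_digraph.graph_dist_ge_2 wf_digraph_FJ) (simp_all only: arcs_ends_FJ, simp_all)
  have verts: "verts (FJ n (n - 1)) = ?V"
    by (simp add: FJ_def)
  show ?thesis
    unfolding graph_diameter_def verts
  proof (rule antisym)
    show "(SUP (u, v) \<in> ?V \<times> ?V. graph_dist (FJ n (n - 1)) u v) \<le> 2"
      using assms graph_dist_FJ_le_2[of _ n] by (intro SUP_least) auto
    show "2 \<le> (SUP (u, v) \<in> ?V \<times> ?V. graph_dist (FJ n (n - 1)) u v)"
      using uv ge by (intro SUP_upper2[of "(?u, ?v)"]) auto
  qed
qed

end
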